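(* Let $\mathfrak{g}$ be an $n$-dimensional Lie algebra over $\mathbb{K}$ ($\mathbb{K}=\mathbb{R}$ or $\mathbb{C}$) with ordered basis $X_1,\dots,X_n$ and structure constants $C_{\mu\nu\alpha}$, $[X_\mu,X_\nu]=\sum_{\alpha=1}^n C_{\mu\nu\alpha}X_\alpha$, and let $\mathfrak{g}^L\supset\mathfrak{g}$ be the Lie algebra with basis $\{X_\mu,T_{\mu\nu}\mid 1\le\mu,\nu\le n\}$ described in the context. Let $\blacktriangleright\colon U(\mathfrak{g}^L)\otimes U(\mathfrak{g})\to U(\mathfrak{g})$, $a\otimes X\mapsto a\blacktriangleright X$, be the linear map defined by $$1\blacktriangleright X=X,\qquad X_\mu\blacktriangleright X=X_\mu X,\qquad T_{\mu\nu}\blacktriangleright 1=\delta_{\mu\nu},$$ and $(ab)\blacktriangleright X=a\blacktriangleright(b\blacktriangleright X)$, for all $X\in U(\mathfrak{g})$, $a,b\in U(\mathfrak{g}^L)$, $1\le\mu,\nu\le n$. Then $\blacktriangleright$ is a (well-defined) left action of $U(\mathfrak{g}^L)$ on $U(\mathfrak{g})$, and it satisfies $$T_{\mu\nu}\blacktriangleright(XY)=\sum_{\alpha=1}^n (T_{\mu\alpha}\blacktriangleright X)\,(T_{\alpha\nu}\blacktriangleright Y)$$ for all $X,Y\in U(\mathfrak{g})$ and all $1\le\mu,\nu\le n$.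
   Context: $U(\cdot)$ denotes the universal enveloping algebra, and $U(\mathfrak{g})$ is regarded as a subalgebra of $U(\mathfrak{g}^L)$. Elements of the Lie algebras are identified with their images in the enveloping algebras. $\mathfrak{g}^L$ is the Lie algebra over $\mathbb{K}$ with basis $\{X_\mu, T_{\mu\nu}\mid 1\le\mu,\nu\le n\}$ and brackets $$[X_\mu,X_\nu]=\sum_{\alpha=1}^n C_{\mu\nu\alpha}X_\alpha,\qquad [T_{\mu\nu},T_{\alpha\beta}]=0,\qquad [T_{\mu\nu},X_\lambda]=\sum_{\alpha=1}^n C_{\mu\lambda\alpha}T_{\alpha\nu}.$$ $\delta_{\mu\nu}$ is the Kronecker delta (times the unit of $U(\mathfrak{g})$). *)

theory Defs
  imports
    "HOL-Analysis.Analysis"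
    "HOL-Library.Poly_Mapping"
    "HOL-Algebra.QuotRing"
    "HOL-Algebra.Module"
begin

locale lie_algebra = vector_space scale
  for scale :: "'k::field \<Rightarrow> 'g::ab_group_add \<Rightarrow> 'g" +
  fixes bracket :: "'g \<Rightarrow> 'g \<Rightarrow> 'g"
  assumes bracket_add_left: "bracket (x + y) z = bracket x z + bracket y z"
    and bracket_add_right: "bracket x (y + z) = bracket x y + bracket x z"
    and bracket_scale_left: "bracket (scale c x) y = scale c (bracket x y)"
    and bracket_scale_right: "bracket x (scale c y) = scale c (bracket x y)"
    and bracket_alternating: "bracket x x = 0"
    and jacobi: "bracket x (bracket y z) + bracket y (bracket z x) + bracket z (bracket x y) = 0"

definition (in vector_space) indexed_basis :: "('i \<Rightarrow> 'b) \<Rightarrow> bool" where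
  "indexed_basis X \<longleftrightarrow> inj X \<and> independent (range X) \<and> span (range X) = UNIV"

text \<open>
  Words over an alphabet form a monoid, written additively so that
  \<open>'g free_monoid \<Rightarrow>\<^sub>0 'k\<close> with its convolution product is the free associative unital
  \<open>'k\<close>-algebra on the set of all elements of \<open>'g\<close>.
\<close>

datatype 'a free_monoid = Word "'a list"

instantiation free_monoid :: (type) monoid_add
begin

definition zero_free_monoid :: "'a free_monoid" where
  "zero_free_monoid = Word []"

fun plus_free_monoid :: "'a free_monoid \<Rightarrow> 'a free_monoid \<Rightarrow> 'a free_monoid" where
  "plus_free_monoid (Word u) (Word v) = Word (u @ v)"

instance
proof
  fix a b c :: "'a free_monoid"
  show "a + b + c = a + (b + c)"
    by (cases a; cases b; cases c) simp
  show "0 + a = a" "a + 0 = a"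
    by (cases a; simp add: zero_free_monoid_def)+
qed

end

type_synonym ('g, 'k) free_alg = "'g free_monoid \<Rightarrow>\<^sub>0 'k"

definition free_alg :: "('g, 'k::field) free_alg ring" where
  "free_alg = \<lparr>carrier = UNIV, mult = (*), one = 1, zero = 0, add = (+)\<rparr>"

lemma ring_free_alg: "ring (free_alg :: ('g, 'k::field) free_alg ring)"
proof (rule ringI)
  show "abelian_group (free_alg :: ('g, 'k) free_alg ring)"
  proof (rule abelian_groupI)
    fix x :: "('g, 'k) free_alg"
    show "\<exists>y\<in>carrier free_alg. y \<oplus>\<^bsub>free_alg\<^esub> x = \<zero>\<^bsub>free_alg\<^esub>"
      by (rule bexI[of _ "- x"]) (simp_all add: free_alg_def)
  qed (simp_all add: free_alg_def add_ac)
  show "monoid (free_alg :: ('g, 'k) free_alg ring)"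
    by (rule monoidI) (simp_all add: free_alg_def mult.assoc)
qed (simp_all add: free_alg_def distrib_left distrib_right)

definition letter :: "'g \<Rightarrow> ('g, 'k::field) free_alg" where
  "letter x = Poly_Mapping.single (Word [x]) 1"

definition const :: "'k \<Rightarrow> ('g, 'k::field) free_alg" where
  "const c = Poly_Mapping.single 0 c"

text \<open>
  The first two families of relations are the linear ones: the free algebra on the set
  \<open>'g\<close> modulo these is the tensor algebra of the vector space \<open>'g\<close>.
\<close>

definition uea_relations ::
    "('k \<Rightarrow> 'g \<Rightarrow> 'g) \<Rightarrow> ('g \<Rightarrow> 'g \<Rightarrow> 'g) \<Rightarrow> ('g::ab_group_add, 'k::field) free_alg set" where
  "uea_relations smul bracket =
     {letter (x + y) - (letter x + letter y) | x y. True} \<union>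
     {letter (smul c x) - const c * letter x | c x. True} \<union>
     {letter x * letter y - letter y * letter x - letter (bracket x y) | x y. True}"

definition uea_ideal ::
    "('k \<Rightarrow> 'g \<Rightarrow> 'g) \<Rightarrow> ('g \<Rightarrow> 'g \<Rightarrow> 'g) \<Rightarrow> ('g::ab_group_add, 'k::field) free_alg set" where
  "uea_ideal smul bracket = genideal free_alg (uea_relations smul bracket)"

lemma ideal_uea_ideal: "ideal (uea_ideal smul bracket) free_alg"
  unfolding uea_ideal_def by (rule ring.genideal_ideal[OF ring_free_alg]) (simp add: free_alg_def)

definition uea_class ::
    "('k \<Rightarrow> 'g \<Rightarrow> 'g) \<Rightarrow> ('g \<Rightarrow> 'g \<Rightarrow> 'g) \<Rightarrow> ('g, 'k) free_alg \<Rightarrow>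
     ('g::ab_group_add, 'k::field) free_alg set" where
  "uea_class smul bracket p = uea_ideal smul bracket +>\<^bsub>free_alg\<^esub> p"

definition uea ::
    "('k \<Rightarrow> 'g \<Rightarrow> 'g) \<Rightarrow> ('g \<Rightarrow> 'g \<Rightarrow> 'g) \<Rightarrow>
     ('k, ('g::ab_group_add, 'k::field) free_alg set) module" where
  "uea smul bracket =
     (let Q = free_alg Quot uea_ideal smul bracket in
      \<lparr>carrier = carrier Q, mult = mult Q, one = one Q, zero = zero Q, add = add Q,
       smult = (\<lambda>c u. uea_class smul bracket (const c) \<otimes>\<^bsub>Q\<^esub> u)\<rparr>)"

definition uea_incl ::
    "('k \<Rightarrow> 'g \<Rightarrow> 'g) \<Rightarrow> ('g \<Rightarrow> 'g \<Rightarrow> 'g) \<Rightarrow> 'g \<Rightarrow>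
     ('g::ab_group_add, 'k::field) free_alg set" where
  "uea_incl smul bracket x = uea_class smul bracket (letter x)"

text \<open>
  The underlying vector space of \<open>\<gg>\<^sup>L\<close> has coordinates indexed by \<open>'n + 'n \<times> 'n\<close>: the index
  \<open>Inl \<mu>\<close> belongs to the basis vector \<open>X\<^sub>\<mu>\<close> and \<open>Inr (\<mu>, \<nu>)\<close> to \<open>T\<^sub>\<mu>\<^sub>\<nu>\<close>.
\<close>

type_synonym ('k, 'n) gL = "'k ^ ('n + 'n \<times> 'n)"

definition gL_X :: "'n \<Rightarrow> ('k::field, 'n::finite) gL" where
  "gL_X \<mu> = axis (Inl \<mu>) 1"

definition gL_T :: "'n \<Rightarrow> 'n \<Rightarrow> ('k::field, 'n::finite) gL" where
  "gL_T \<mu> \<nu> = axis (Inr (\<mu>, \<nu>)) 1"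

fun gL_basis_bracket ::
    "('n \<Rightarrow> 'n \<Rightarrow> 'n \<Rightarrow> 'k) \<Rightarrow> 'n + 'n \<times> 'n \<Rightarrow> 'n + 'n \<times> 'n \<Rightarrow> ('k::field, 'n::finite) gL" where
  "gL_basis_bracket C (Inl \<mu>) (Inl \<nu>) = (\<Sum>\<alpha>\<in>UNIV. C \<mu> \<nu> \<alpha> *s gL_X \<alpha>)"
| "gL_basis_bracket C (Inr (\<mu>, \<nu>)) (Inr (\<alpha>, \<beta>)) = 0"
| "gL_basis_bracket C (Inr (\<mu>, \<nu>)) (Inl \<kappa>) = (\<Sum>\<alpha>\<in>UNIV. C \<mu> \<kappa> \<alpha> *s gL_T \<alpha> \<nu>)"
| "gL_basis_bracket C (Inl \<kappa>) (Inr (\<mu>, \<nu>)) = - (\<Sum>\<alpha>\<in>UNIV. C \<mu> \<kappa> \<alpha> *s gL_T \<alpha> \<nu>)"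

definition gL_bracket ::
    "('n \<Rightarrow> 'n \<Rightarrow> 'n \<Rightarrow> 'k) \<Rightarrow> ('k, 'n) gL \<Rightarrow> ('k, 'n) gL \<Rightarrow> ('k::field, 'n::finite) gL" where
  "gL_bracket C u v = (\<Sum>i\<in>UNIV. \<Sum>j\<in>UNIV. (u $ i * v $ j) *s gL_basis_bracket C i j)"

lemma gL_bracket_add:
  "gL_bracket C (u + u') v = gL_bracket C u v + gL_bracket C u' v"
  "gL_bracket C u (v + v') = gL_bracket C u v + gL_bracket C u v'"
  by (simp_all add: gL_bracket_def distrib_left distrib_right vec.scale_left_distrib sum.distrib)

lemma gL_bracket_scale:
  "gL_bracket C (c *s u) v = c *s gL_bracket C u v"
  "gL_bracket C u (c *s v) = c *s gL_bracket C u v"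
  by (simp_all add: gL_bracket_def vec.scale_sum_right mult.assoc mult.left_commute)

lemma gL_bracket_axis:
  "gL_bracket C (axis i 1) (axis j 1) = gL_basis_bracket C i j"
proof -
  have *: "(axis i (1::'a) $ i' * axis j 1 $ j') *s gL_basis_bracket C i' j' =
        (if j' = j then (if i' = i then gL_basis_bracket C i j else 0) else 0)" for i' j'
    by (auto simp: axis_def)
  show ?thesis
    unfolding gL_bracket_def * by simp
qed

lemma gL_bracket_zero: "gL_bracket C 0 v = 0" "gL_bracket C u 0 = 0"
  by (simp_all add: gL_bracket_def)

lemma gL_bracket_minus:
  "gL_bracket C (- u) v = - gL_bracket C u v" "gL_bracket C u (- v) = - gL_bracket C u v"
  using gL_bracket_scale(1)[of C "- 1" u v] gL_bracket_scale(2)[of C u "- 1" v] by simp_all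

lemma gL_bracket_sum:
  "finite A \<Longrightarrow> gL_bracket C (sum f A) v = (\<Sum>a\<in>A. gL_bracket C (f a) v)"
  "finite A \<Longrightarrow> gL_bracket C u (sum f A) = (\<Sum>a\<in>A. gL_bracket C u (f a))"
  by (induction A rule: finite_induct) (simp_all add: gL_bracket_zero gL_bracket_add)

lemma gL_brackets:
  "gL_bracket C (gL_X \<mu>) (gL_X \<nu>) = (\<Sum>\<alpha>\<in>UNIV. C \<mu> \<nu> \<alpha> *s gL_X \<alpha>)"
  "gL_bracket C (gL_T \<mu> \<nu>) (gL_T \<alpha> \<beta>) = 0"
  "gL_bracket C (gL_T \<mu> \<nu>) (gL_X \<kappa>) = (\<Sum>\<alpha>\<in>UNIV. C \<mu> \<kappa> \<alpha> *s gL_T \<alpha> \<nu>)"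
  "gL_bracket C (gL_X \<kappa>) (gL_T \<mu> \<nu>) = - (\<Sum>\<alpha>\<in>UNIV. C \<mu> \<kappa> \<alpha> *s gL_T \<alpha> \<nu>)"
  by (simp_all add: gL_bracket_axis gL_X_def gL_T_def)

lemma gL_induct:
  fixes f :: "('k::field, 'n::finite) gL \<Rightarrow> ('k, 'n) gL"
  assumes "\<And>u v. f (u + v) = f u + f v" and "\<And>c u. f (c *s u) = c *s f u"
    and X: "\<And>\<mu>. f (gL_X \<mu>) = 0" and T: "\<And>\<mu> \<nu>. f (gL_T \<mu> \<nu>) = 0"
  shows "f u = 0"
proof -
  have lin: "Vector_Spaces.linear (*s) (*s) f"
    by unfold_locales (use assms in auto)
  have ax: "f (axis i 1) = 0" for i
  proof (cases i)
    case (Inl \<mu>)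
    then show ?thesis using X[of \<mu>] by (simp add: gL_X_def)
  next
    case (Inr p)
    then show ?thesis using T[of "fst p" "snd p"] by (simp add: gL_T_def)
  qed
  have "f u = f (\<Sum>i\<in>UNIV. u $ i *s axis i 1)"
    by (simp add: basis_expansion)
  also have "\<dots> = (\<Sum>i\<in>UNIV. u $ i *s f (axis i 1))"
    by (simp add: vec.linear_sum[OF lin] vec.linear_scale[OF lin])
  finally show ?thesis by (simp add: ax)
qed

context lie_algebra
begin

lemma bracket_antisym: "bracket x y = - bracket y x"
proof -
  have "0 = bracket (x + y) (x + y)" by (simp add: bracket_alternating)
  also have "\<dots> = bracket x x + bracket x y + (bracket y x + bracket y y)"
    by (simp only: bracket_add_left bracket_add_right add_ac)
  also have "\<dots> = bracket x y + bracket y x" by (simp add: bracket_alternating)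
  finally show ?thesis by (metis eq_neg_iff_add_eq_0)
qed

lemma bracket_sum_right: "finite A \<Longrightarrow> bracket x (sum f A) = (\<Sum>a\<in>A. bracket x (f a))"
proof (induction A rule: finite_induct)
  case empty
  show ?case using bracket_add_right[of x 0 0] by simp
qed (simp add: bracket_add_right)

lemma indexed_basis_coeff_zero:
  fixes X :: "'n::finite \<Rightarrow> 'g"
  assumes "indexed_basis X" "(\<Sum>\<alpha>\<in>UNIV. scale (a \<alpha>) (X \<alpha>)) = 0"
  shows "a \<alpha> = 0"
proof -
  have inj: "inj X" and ind: "independent (range X)"
    using assms(1) by (auto simp: indexed_basis_def)
  have "(\<Sum>v\<in>range X. scale (a (inv_into UNIV X v)) v) = 0"
    using assms(2) by (simp add: sum.reindex[OF inj] inv_f_f[OF inj])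
  then have "a (inv_into UNIV X (X \<alpha>)) = 0"
    using ind independentD[of "range X" "range X" "\<lambda>v. a (inv_into UNIV X v)" "X \<alpha>"] by auto
  then show ?thesis by (simp add: inv_f_f[OF inj])
qed

context
  fixes X :: "'n::finite \<Rightarrow> 'g" and C :: "'n \<Rightarrow> 'n \<Rightarrow> 'n \<Rightarrow> 'k"
  assumes basis: "indexed_basis X"
    and structure_eq: "\<And>\<mu> \<nu>. bracket (X \<mu>) (X \<nu>) = (\<Sum>\<alpha>\<in>UNIV. scale (C \<mu> \<nu> \<alpha>) (X \<alpha>))"
begin

lemma structure_constants_antisym: "C \<mu> \<nu> \<alpha> = - C \<nu> \<mu> \<alpha>"
proof -
  have "(\<Sum>\<alpha>\<in>UNIV. scale (C \<mu> \<nu> \<alpha> + C \<nu> \<mu> \<alpha>) (X \<alpha>)) = 0"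
    using bracket_antisym[of "X \<mu>" "X \<nu>"]
    by (simp add: structure_eq scale_left_distrib sum.distrib)
  from indexed_basis_coeff_zero[OF basis this, of \<alpha>] show ?thesis
    by (simp add: eq_neg_iff_add_eq_0)
qed

lemma structure_constants_jacobi:
  "(\<Sum>\<alpha>\<in>UNIV. C \<nu> \<kappa> \<alpha> * C \<mu> \<alpha> \<beta> + C \<kappa> \<mu> \<alpha> * C \<nu> \<alpha> \<beta> + C \<mu> \<nu> \<alpha> * C \<kappa> \<alpha> \<beta>) = 0"
proof -
  have *: "bracket (X \<mu>) (bracket (X \<nu>) (X \<kappa>)) =
      (\<Sum>\<beta>\<in>UNIV. scale (\<Sum>\<alpha>\<in>UNIV. C \<nu> \<kappa> \<alpha> * C \<mu> \<alpha> \<beta>) (X \<beta>))" for \<mu> \<nu> \<kappa>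
  proof -
    have "bracket (X \<mu>) (bracket (X \<nu>) (X \<kappa>)) =
        (\<Sum>\<alpha>\<in>UNIV. \<Sum>\<beta>\<in>UNIV. scale (C \<nu> \<kappa> \<alpha> * C \<mu> \<alpha> \<beta>) (X \<beta>))"
      by (simp add: structure_eq bracket_sum_right bracket_scale_right scale_sum_right)
    also have "\<dots> = (\<Sum>\<beta>\<in>UNIV. scale (\<Sum>\<alpha>\<in>UNIV. C \<nu> \<kappa> \<alpha> * C \<mu> \<alpha> \<beta>) (X \<beta>))"
      by (subst sum.swap) (simp add: scale_sum_left)
    finally show ?thesis .
  qed
  have "(\<Sum>\<beta>\<in>UNIV. scale (\<Sum>\<alpha>\<in>UNIV. C \<nu> \<kappa> \<alpha> * C \<mu> \<alpha> \<beta> + C \<kappa> \<mu> \<alpha> * C \<nu> \<alpha> \<beta>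
      + C \<mu> \<nu> \<alpha> * C \<kappa> \<alpha> \<beta>) (X \<beta>)) = 0"
    using jacobi[of "X \<mu>" "X \<nu>" "X \<kappa>"]
    unfolding * by (simp add: scale_left_distrib sum.distrib)
  from indexed_basis_coeff_zero[OF basis this, of \<beta>] show ?thesis .
qed

end

end

lemma lie_algebra_gL:
  fixes scale :: "'k::field_char_0 \<Rightarrow> 'g::ab_group_add \<Rightarrow> 'g"
    and X :: "'n::finite \<Rightarrow> 'g" and C :: "'n \<Rightarrow> 'n \<Rightarrow> 'n \<Rightarrow> 'k"
  assumes "lie_algebra scale bracket"
    and basis: "vector_space.indexed_basis scale X"
    and structure_eq: "\<And>\<mu> \<nu>. bracket (X \<mu>) (X \<nu>) = (\<Sum>\<alpha>\<in>UNIV. scale (C \<mu> \<nu> \<alpha>) (X \<alpha>))"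
  shows "lie_algebra (*s) (gL_bracket C)"
proof -
  interpret lie_algebra scale bracket by fact
  note CA = structure_constants_antisym[OF basis structure_eq]
  note CJ = structure_constants_jacobi[OF basis structure_eq]
  note lin = gL_bracket_add gL_bracket_scale vec.scale_right_distrib
    vec.scale_right_diff_distrib
  let ?b = "gL_bracket C"
  have anti_basis: "gL_basis_bracket C i j = - gL_basis_bracket C j i" for i j
  proof (cases i; cases j)
    fix \<mu> \<nu> assume ij: "i = Inl \<mu>" "j = Inl \<nu>"
    have "C \<mu> \<nu> \<alpha> *s gL_X \<alpha> = - (C \<nu> \<mu> \<alpha> *s gL_X \<alpha>)" for \<alpha>
      by (subst CA) simp
    then show ?thesis by (simp add: ij sum_negf)
  qed auto
  have anti: "?b u v = - ?b v u" for u v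
    unfolding gL_bracket_def
    by (subst sum.swap, subst anti_basis) (simp add: sum_negf mult.commute)
  have alt: "?b u u = 0" for u
    using anti[of u u] by (simp add: vec_eq_iff)
  define J where "J u v w = ?b u (?b v w) + ?b v (?b w u) + ?b w (?b u v)" for u v w
  have cyc: "J u v w = J v w u" for u v w
    by (simp add: J_def)
  have J_lin: "J (u + u') v w = J u v w + J u' v w" "J (c *s u) v w = c *s J u v w" for u u' v w c
    by (simp_all add: J_def lin algebra_simps)
  have J_lin2: "J v (u + u') w = J v u w + J v u' w" "J v (c *s u) w = c *s J v u w" for u u' v w c
    by (simp_all add: J_def lin algebra_simps)
  have J_lin3: "J v w (u + u') = J v w u + J v w u'" "J v w (c *s u) = c *s J v w u" for u u' v w c
    by (simp_all add: J_def lin algebra_simps)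
  have XXX: "J (gL_X \<mu>) (gL_X \<nu>) (gL_X \<kappa>) = 0" for \<mu> \<nu> \<kappa>
  proof -
    have *: "?b (gL_X \<mu>) (?b (gL_X \<nu>) (gL_X \<kappa>)) =
        (\<Sum>\<beta>\<in>UNIV. (\<Sum>\<alpha>\<in>UNIV. C \<nu> \<kappa> \<alpha> * C \<mu> \<alpha> \<beta>) *s gL_X \<beta>)" for \<mu> \<nu> \<kappa>
      by (simp add: gL_brackets gL_bracket_sum gL_bracket_scale vec.scale_sum_right
          vec.scale_sum_left) (rule sum.swap)
    have "J (gL_X \<mu>) (gL_X \<nu>) (gL_X \<kappa>) = (\<Sum>\<beta>\<in>UNIV. (\<Sum>\<alpha>\<in>UNIV. C \<nu> \<kappa> \<alpha> * C \<mu> \<alpha> \<beta>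
        + C \<kappa> \<mu> \<alpha> * C \<nu> \<alpha> \<beta> + C \<mu> \<nu> \<alpha> * C \<kappa> \<alpha> \<beta>) *s gL_X \<beta>)"
      unfolding J_def * by (simp add: vec.scale_left_distrib sum.distrib)
    then show ?thesis by (simp add: CJ)
  qed
  have XXT: "J (gL_X \<mu>) (gL_X \<nu>) (gL_T \<kappa> \<rho>) = 0" for \<mu> \<nu> \<kappa> \<rho>
  proof -
    have 1: "?b (gL_X \<mu>) (?b (gL_X \<nu>) (gL_T \<kappa> \<rho>)) =
        (\<Sum>\<beta>\<in>UNIV. (\<Sum>\<alpha>\<in>UNIV. C \<kappa> \<nu> \<alpha> * C \<alpha> \<mu> \<beta>) *s gL_T \<beta> \<rho>)" for \<mu> \<nu>
      by (simp add: gL_brackets gL_bracket_sum gL_bracket_scale gL_bracket_minus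
          vec.scale_sum_right vec.scale_sum_left sum_negf) (rule sum.swap)
    have 2: "?b (gL_X \<nu>) (?b (gL_T \<kappa> \<rho>) (gL_X \<mu>)) =
        (\<Sum>\<beta>\<in>UNIV. (\<Sum>\<alpha>\<in>UNIV. - (C \<kappa> \<mu> \<alpha> * C \<alpha> \<nu> \<beta>)) *s gL_T \<beta> \<rho>)"
      using 1[of \<nu> \<mu>] by (subst anti, simp add: gL_bracket_minus sum_negf)
    have 3: "?b (gL_T \<kappa> \<rho>) (?b (gL_X \<mu>) (gL_X \<nu>)) =
        (\<Sum>\<beta>\<in>UNIV. (\<Sum>\<alpha>\<in>UNIV. C \<mu> \<nu> \<alpha> * C \<kappa> \<alpha> \<beta>) *s gL_T \<beta> \<rho>)"
      by (simp add: gL_brackets gL_bracket_sum gL_bracket_scale vec.scale_sum_right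
          vec.scale_sum_left) (rule sum.swap)
    have *: "C \<kappa> \<nu> \<alpha> * C \<alpha> \<mu> \<beta> = C \<nu> \<kappa> \<alpha> * C \<mu> \<alpha> \<beta>"
        "- (C \<kappa> \<mu> \<alpha> * C \<alpha> \<nu> \<beta>) = C \<kappa> \<mu> \<alpha> * C \<nu> \<alpha> \<beta>" for \<alpha> \<beta>
      using CA[of \<kappa> \<nu> \<alpha>] CA[of \<alpha> \<mu> \<beta>] CA[of \<alpha> \<nu> \<beta>] by simp_all
    have "J (gL_X \<mu>) (gL_X \<nu>) (gL_T \<kappa> \<rho>) = (\<Sum>\<beta>\<in>UNIV. (\<Sum>\<alpha>\<in>UNIV. C \<nu> \<kappa> \<alpha> * C \<mu> \<alpha> \<beta>
        + C \<kappa> \<mu> \<alpha> * C \<nu> \<alpha> \<beta> + C \<mu> \<nu> \<alpha> * C \<kappa> \<alpha> \<beta>) *s gL_T \<beta> \<rho>)"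
      unfolding J_def 1 2 3 * by (simp add: vec.scale_left_distrib sum.distrib)
    then show ?thesis by (simp add: CJ)
  qed
  have XTT: "J (gL_X \<mu>) (gL_T \<nu> \<nu>') (gL_T \<kappa> \<rho>) = 0" for \<mu> \<nu> \<nu>' \<kappa> \<rho>
    by (simp add: J_def gL_brackets gL_bracket_sum gL_bracket_scale gL_bracket_minus
        gL_bracket_zero)
  have TTT: "J (gL_T \<mu> \<mu>') (gL_T \<nu> \<nu>') (gL_T \<kappa> \<rho>) = 0" for \<mu> \<mu>' \<nu> \<nu>' \<kappa> \<rho>
    by (simp add: J_def gL_brackets gL_bracket_zero)
  have XX: "J (gL_X \<mu>) (gL_X \<nu>) w = 0" for \<mu> \<nu> w
    by (rule gL_induct[where f = "J (gL_X \<mu>) (gL_X \<nu>)"]) (simp_all add: J_lin3 XXX XXT)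
  have XT: "J (gL_X \<mu>) (gL_T \<nu> \<nu>') w = 0" for \<mu> \<nu> \<nu>' w
  proof (rule gL_induct[where f = "J (gL_X \<mu>) (gL_T \<nu> \<nu>')"])
    show "J (gL_X \<mu>) (gL_T \<nu> \<nu>') (gL_X \<kappa>) = 0" for \<kappa>
      by (metis cyc XXT)
  qed (simp_all add: J_lin3 XTT)
  have TT: "J (gL_T \<mu> \<mu>') (gL_T \<nu> \<nu>') w = 0" for \<mu> \<mu>' \<nu> \<nu>' w
  proof (rule gL_induct[where f = "J (gL_T \<mu> \<mu>') (gL_T \<nu> \<nu>')"])
    show "J (gL_T \<mu> \<mu>') (gL_T \<nu> \<nu>') (gL_X \<kappa>) = 0" for \<kappa>
      by (metis cyc XTT)
  qed (simp_all add: J_lin3 TTT)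
  have TX: "J (gL_T \<mu> \<mu>') (gL_X \<nu>) w = 0" for \<mu> \<mu>' \<nu> w
  proof (rule gL_induct[where f = "J (gL_T \<mu> \<mu>') (gL_X \<nu>)"])
    show "J (gL_T \<mu> \<mu>') (gL_X \<nu>) (gL_X \<kappa>) = 0" for \<kappa>
      by (metis cyc XX)
    show "J (gL_T \<mu> \<mu>') (gL_X \<nu>) (gL_T \<kappa> \<kappa>') = 0" for \<kappa> \<kappa>'
      by (metis cyc XT)
  qed (simp_all add: J_lin3)
  have X: "J (gL_X \<mu>) v w = 0" for \<mu> v w
    by (rule gL_induct[where f = "\<lambda>v. J _ v w"]) (simp_all add: J_lin2 XX XT)
  have T: "J (gL_T \<mu> \<nu>) v w = 0" for \<mu> \<nu> v w
    by (rule gL_induct[where f = "\<lambda>v. J _ v w"]) (simp_all add: J_lin2 TX TT)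
  have "J u v w = 0" for u v w
    by (rule gL_induct[where f = "\<lambda>u. J u v w"]) (simp_all add: J_lin X T)
  then show ?thesis
    by unfold_locales (simp_all add: gL_bracket_add gL_bracket_scale alt J_def)
qed

text \<open>Linear maps out of a tensor product are rendered as bilinear maps:\<close>

definition bilinear_map ::
    "('k, 'a, 'm) module_scheme \<Rightarrow> ('k, 'b, 'n) module_scheme \<Rightarrow> ('k, 'c, 'o) module_scheme \<Rightarrow>
     ('a \<Rightarrow> 'b \<Rightarrow> 'c) \<Rightarrow> bool" where
  "bilinear_map A B M f \<longleftrightarrow>
     (\<forall>a\<in>carrier A. \<forall>x\<in>carrier B. f a x \<in> carrier M) \<and>
     (\<forall>a\<in>carrier A. \<forall>b\<in>carrier A. \<forall>x\<in>carrier B. f (a \<oplus>\<^bsub>A\<^esub> b) x = f a x \<oplus>\<^bsub>M\<^esub> f b x) \<and>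
     (\<forall>a\<in>carrier A. \<forall>x\<in>carrier B. \<forall>y\<in>carrier B. f a (x \<oplus>\<^bsub>B\<^esub> y) = f a x \<oplus>\<^bsub>M\<^esub> f a y) \<and>
     (\<forall>c. \<forall>a\<in>carrier A. \<forall>x\<in>carrier B. f (c \<odot>\<^bsub>A\<^esub> a) x = c \<odot>\<^bsub>M\<^esub> f a x) \<and>
     (\<forall>c. \<forall>a\<in>carrier A. \<forall>x\<in>carrier B. f a (c \<odot>\<^bsub>B\<^esub> x) = c \<odot>\<^bsub>M\<^esub> f a x)"

definition left_action ::
    "('k, 'a, 'm) module_scheme \<Rightarrow> ('k, 'b, 'n) module_scheme \<Rightarrow> ('a \<Rightarrow> 'b \<Rightarrow> 'b) \<Rightarrow> bool" where
  "left_action A M f \<longleftrightarrow> bilinear_map A M M f \<and>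
     (\<forall>x\<in>carrier M. f \<one>\<^bsub>A\<^esub> x = x) \<and>
     (\<forall>a\<in>carrier A. \<forall>b\<in>carrier A. \<forall>x\<in>carrier M. f (a \<otimes>\<^bsub>A\<^esub> b) x = f a (f b x))"

text \<open>
  The defining conditions of \<open>\<blacktriangleright>\<close>. Values outside the carriers are fixed by extensionality,
  so that uniqueness of the map can be expressed by equality of functions.
\<close>

definition triangle_map ::
    "('k::field \<Rightarrow> 'g::ab_group_add \<Rightarrow> 'g) \<Rightarrow> ('g \<Rightarrow> 'g \<Rightarrow> 'g) \<Rightarrow>
     ('n::finite \<Rightarrow> 'g) \<Rightarrow> ('n \<Rightarrow> 'n \<Rightarrow> 'n \<Rightarrow> 'k) \<Rightarrow>
     ((('k, 'n) gL, 'k) free_alg set \<Rightarrow> ('g, 'k) free_alg set \<Rightarrow> ('g, 'k) free_alg set) \<Rightarrow>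
     bool" where
  "triangle_map smul bracket X C act \<longleftrightarrow>
     (let U = uea smul bracket; \<iota> = uea_incl smul bracket;
          UL = uea (*s) (gL_bracket C); \<iota>L = uea_incl (*s) (gL_bracket C)
      in act \<in> carrier UL \<rightarrow>\<^sub>E carrier U \<rightarrow>\<^sub>E carrier U \<and>
         bilinear_map UL U U act \<and>
         (\<forall>x\<in>carrier U. act \<one>\<^bsub>UL\<^esub> x = x) \<and>
         (\<forall>\<mu>. \<forall>x\<in>carrier U. act (\<iota>L (gL_X \<mu>)) x = \<iota> (X \<mu>) \<otimes>\<^bsub>U\<^esub> x) \<and>
         (\<forall>\<mu> \<nu>. act (\<iota>L (gL_T \<mu> \<nu>)) \<one>\<^bsub>U\<^esub> = (if \<mu> = \<nu> then \<one>\<^bsub>U\<^esub> else \<zero>\<^bsub>U\<^esub>)) \<and>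
         (\<forall>a\<in>carrier UL. \<forall>b\<in>carrier UL. \<forall>x\<in>carrier U. act (a \<otimes>\<^bsub>UL\<^esub> b) x = act a (act b x)))"

end

(*
  Reading T_{mu nu} |> x as the (mu, nu) entry of a matrix, the required coproduct rule says that
  x |-> (T_{mu nu} |> x) is an algebra homomorphism from U(g) to matrices over U(g), and the
  brackets force X_lambda to go to X_lambda times the identity plus the matrix of
  [., X_lambda]. This prescription is compatible with the defining relations of U(g) by the Jacobi
  identity. All operators are built on the free algebra, where they are defined by recursion on
  words, and then shown to preserve the ideal of relations; on the free algebra the T_{mu nu}
  already commute exactly. Conversely, every map satisfying the defining conditions agrees with
  this one, since T_{mu nu} can be moved past each X_lambda until it acts on 1.
*)

theory Submission
  imports Defs
begin

section \<open>Scalars inside the free algebra\<close>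

lemma const_add: "const (a + b) = const a + const b"
  by (simp add: const_def single_add)

lemma const_0 [simp]: "const 0 = 0"
  by (simp add: const_def)

lemma const_1 [simp]: "const 1 = 1"
  by (simp add: const_def)

lemma const_mult: "const (a * b) = const a * const b"
  by (simp add: const_def mult_single)

lemma const_uminus: "const (- a) = - const a"
  by (simp add: const_def single_uminus)

lemma const_diff: "const (a - b) = const a - const b"
  by (simp add: const_def single_diff)

lemma const_sum: "const (sum f A) = (\<Sum>a\<in>A. const (f a))"
  by (induction A rule: infinite_finite_induct) (simp_all add: const_add)

section \<open>Induction and linear extension over words\<close>

lemma poly_mapping_single_induct [case_names single add]:
  assumes "\<And>k v. P (Poly_Mapping.single k v)"
    and "\<And>p q. P p \<Longrightarrow> P q \<Longrightarrow> P (p + q)"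
  shows "P p"
proof (induction p rule: update_induct)
  case const
  then show ?case using assms(1)[of undefined 0] by simp
next
  case (update p k v)
  have "Poly_Mapping.update k v p = Poly_Mapping.single k v + p"
    using update(1)
    by (intro poly_mapping_eqI) (auto simp: lookup_update lookup_add lookup_single when_def in_keys_iff)
  then show ?case using assms update by simp
qed

lemma const_commute: "p * const c = const c * p"
proof (induction p rule: poly_mapping_single_induct)
  case (single k v)
  then show ?case by (simp add: const_def mult_single mult.commute)
qed (simp add: algebra_simps)

lemma const_left_commute: "p * (const c * q) = const c * (p * q)"
  by (simp flip: mult.assoc add: const_commute)

lemma const_letter_ac:
  "letter x * const c = const c * letter x"
  "letter x * (const c * q) = const c * (letter x * q)"
  "const a * (const b * q) = const b * (const a * q)"
  by (rule const_commute const_left_commute)+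

lemma letter_mult_single:
  "letter x * Poly_Mapping.single (Word w) c = Poly_Mapping.single (Word (x # w)) c"
  by (simp add: letter_def mult_single)

lemma single_eq_const_mult:
  "Poly_Mapping.single w c = const c * Poly_Mapping.single w (1::'k::field)"
  by (simp add: const_def mult_single)

text \<open>Every word is a product of letters, and every element is a linear combination of words.
  Multiplying by letters on the left only matches the head recursion by which the operators below
  are defined.\<close>

lemma free_alg_induct [case_names one letter const add]:
  assumes one: "P 1"
    and letter: "\<And>x p. P p \<Longrightarrow> P (letter x * p)"
    and const: "\<And>c p. P p \<Longrightarrow> P (const c * p)"
    and add: "\<And>p q. P p \<Longrightarrow> P q \<Longrightarrow> P (p + q)"
  shows "P (p :: ('g, 'k::field) free_alg)"
proof (induction p rule: poly_mapping_single_induct)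
  case (single k v)
  have "P (Poly_Mapping.single (Word w) 1)" for w
  proof (induction w)
    case Nil
    then show ?case using one by (simp flip: zero_free_monoid_def)
  next
    case (Cons x w)
    then show ?case using letter[of "Poly_Mapping.single (Word w) 1" x]
      by (simp add: letter_mult_single)
  qed
  then show ?case
    using const[of "Poly_Mapping.single k 1" v] by (cases k) (simp flip: single_eq_const_mult)
qed (rule add)

text \<open>Scalars enter as products with \<open>const\<close>, so linearity can be used inside the
  ring arithmetic of the free algebra.\<close>

definition lin_ext :: "('b \<Rightarrow> ('g, 'k::field) free_alg) \<Rightarrow> ('b \<Rightarrow>\<^sub>0 'k) \<Rightarrow> ('g, 'k) free_alg" where
  "lin_ext f p = (\<Sum>w\<in>Poly_Mapping.keys p. const (Poly_Mapping.lookup p w) * f w)"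

lemma lin_ext_superset:
  assumes "finite A" "Poly_Mapping.keys p \<subseteq> A"
  shows "lin_ext f p = (\<Sum>w\<in>A. const (Poly_Mapping.lookup p w) * f w)"
  unfolding lin_ext_def
  by (rule sum.mono_neutral_left) (use assms in \<open>auto simp: in_keys_iff\<close>)

lemma lin_ext_single [simp]: "lin_ext f (Poly_Mapping.single w c) = const c * f w"
  by (simp add: lin_ext_superset[of "{w}"])

lemma lin_ext_add: "lin_ext f (p + q) = lin_ext f p + lin_ext f q"
  using Poly_Mapping.keys_add[of p q]
  by (simp add: lin_ext_superset[of "Poly_Mapping.keys p \<union> Poly_Mapping.keys q"] lookup_add const_add
      distrib_right sum.distrib)

lemma lin_ext_0 [simp]: "lin_ext f 0 = 0"
  by (simp add: lin_ext_def)

lemma lin_ext_uminus: "lin_ext f (- p) = - lin_ext f p"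
  using lin_ext_add[of f "- p" p] by (simp add: eq_neg_iff_add_eq_0)

lemma lin_ext_diff: "lin_ext f (p - q) = lin_ext f p - lin_ext f q"
  using lin_ext_add[of f p "- q"] by (simp add: lin_ext_uminus)

lemma lin_ext_const_mult: "lin_ext f (const c * p) = const c * lin_ext f p"
proof (induction p rule: poly_mapping_single_induct)
  case (single k v)
  have "const c * Poly_Mapping.single k v = Poly_Mapping.single k (c * v)"
    by (simp add: const_def mult_single)
  then show ?case by (simp add: const_mult mult.assoc)
qed (simp add: distrib_left lin_ext_add)

lemma lin_ext_one: "lin_ext f 1 = f (Word [])"
  using lin_ext_single[of f 0 1] by (simp flip: zero_free_monoid_def)

lemma lin_ext_letter: "lin_ext f (letter x) = f (Word [x])"
  by (simp add: letter_def)

section \<open>The enveloping algebra as a quotient of the free algebra\<close>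

lemma ideal_free_algI:
  assumes "0 \<in> J" "\<And>p q. p \<in> J \<Longrightarrow> q \<in> J \<Longrightarrow> p + q \<in> J"
    and l: "\<And>p q. p \<in> J \<Longrightarrow> q * p \<in> J" and r: "\<And>p q. p \<in> J \<Longrightarrow> p * q \<in> J"
  shows "ideal J (free_alg :: ('g, 'k::field) free_alg ring)"
proof (rule idealI[OF ring_free_alg])
  interpret ring "free_alg :: ('g, 'k) free_alg ring" by (rule ring_free_alg)
  \<comment> \<open>Negation is multiplication by -1, so closure under negatives comes from closure
    under left multiplication.\<close>
  have inv: "\<ominus>\<^bsub>free_alg\<^esub> p = (-1) * p" for p :: "('g, 'k) free_alg"
    by (rule minus_equality) (simp_all add: free_alg_def)
  show "subgroup J (add_monoid (free_alg :: ('g, 'k) free_alg ring))"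
  proof (rule subgroup.intro)
    show "inv\<^bsub>add_monoid free_alg\<^esub> p \<in> J" if "p \<in> J" for p
      using l[OF that, of "-1"] inv[of p] by (simp add: a_inv_def)
  qed (use assms in \<open>auto simp: free_alg_def\<close>)
qed (use l r in \<open>auto simp: free_alg_def\<close>)

lemma uea_ideal_closed:
  shows uea_ideal_0: "0 \<in> uea_ideal s b"
    and uea_ideal_add: "p \<in> uea_ideal s b \<Longrightarrow> q \<in> uea_ideal s b \<Longrightarrow> p + q \<in> uea_ideal s b"
    and uea_ideal_mult_left: "p \<in> uea_ideal s b \<Longrightarrow> r * p \<in> uea_ideal s b"
    and uea_ideal_mult_right: "p \<in> uea_ideal s b \<Longrightarrow> p * r \<in> uea_ideal s b"
proof -
  interpret ideal "uea_ideal s b" free_alg by (rule ideal_uea_ideal)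
  show "0 \<in> uea_ideal s b"
    using additive_subgroup.zero_closed[OF is_additive_subgroup] by (simp add: free_alg_def)
  show "p \<in> uea_ideal s b \<Longrightarrow> q \<in> uea_ideal s b \<Longrightarrow> p + q \<in> uea_ideal s b"
    using additive_subgroup.a_closed[OF is_additive_subgroup, of p q] by (simp add: free_alg_def)
  show "p \<in> uea_ideal s b \<Longrightarrow> r * p \<in> uea_ideal s b" "p \<in> uea_ideal s b \<Longrightarrow> p * r \<in> uea_ideal s b"
    using I_l_closed[of p r] I_r_closed[of p r] by (simp_all add: free_alg_def)
qed

lemma uea_ideal_uminus: "p \<in> uea_ideal s b \<Longrightarrow> - p \<in> uea_ideal s b"
  using uea_ideal_mult_left[of p s b "-1"] by simp

lemma uea_ideal_sum:
  "(\<And>a. a \<in> A \<Longrightarrow> f a \<in> uea_ideal s b) \<Longrightarrow> sum f A \<in> uea_ideal s b"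
  by (induction A rule: infinite_finite_induct) (auto simp: uea_ideal_0 uea_ideal_add)

lemma uea_relations_in_ideal: "p \<in> uea_relations s b \<Longrightarrow> p \<in> uea_ideal s b"
  using ring.genideal_self[OF ring_free_alg, of "uea_relations s b"]
  unfolding uea_ideal_def by (auto simp: free_alg_def)

lemma uea_ideal_letter_add: "letter (x + y) - (letter x + letter y) \<in> uea_ideal s b"
  and uea_ideal_letter_scale: "letter (s c x) - const c * letter x \<in> uea_ideal s b"
  and uea_ideal_letter_bracket:
    "letter x * letter y - letter y * letter x - letter (b x y) \<in> uea_ideal s b"
  by (rule uea_relations_in_ideal, unfold uea_relations_def, blast)+

text \<open>Iterates the two linear families of relations. It serves to replace a letter by its
  expansion in a basis, modulo the ideal.\<close>

lemma uea_ideal_letter_sum: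
  "letter (\<Sum>a\<in>A. s (c a) (v a)) - (\<Sum>a\<in>A. const (c a) * letter (v a)) \<in> uea_ideal s b"
proof (induction A rule: infinite_finite_induct)
  case (insert a A)
  let ?L = "letter (\<Sum>a\<in>A. s (c a) (v a))" and ?S = "\<Sum>a\<in>A. const (c a) * letter (v a)"
  let ?x = "letter (s (c a) (v a))"
  have "(letter (s (c a) (v a) + (\<Sum>a\<in>A. s (c a) (v a))) - (?x + ?L))
      + (?x - const (c a) * letter (v a)) + (?L - ?S) \<in> uea_ideal s b"
    by (intro uea_ideal_add uea_ideal_letter_add uea_ideal_letter_scale insert.IH)
  then show ?case
    using insert(1,2) by (simp add: algebra_simps)
\<comment> \<open>\<open>letter 0\<close> is a nonzero word. It lies in the ideal because the
  additivity relation for 0 + 0 equals \<open>- letter 0\<close>.\<close>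
qed (use uea_ideal_uminus[OF uea_ideal_letter_add[of 0 0 s b]] in simp_all)

text \<open>The elements satisfying \<open>P\<close> form a two-sided ideal that contains the
  relations, and the generated ideal is the smallest such.\<close>

lemma uea_ideal_induct [consumes 1, case_names zero add left right Add Scale Bracket]:
  assumes "p \<in> uea_ideal s b"
    and zero: "P 0" and add: "\<And>p q. P p \<Longrightarrow> P q \<Longrightarrow> P (p + q)"
    and left: "\<And>p q. P p \<Longrightarrow> P (q * p)" and right: "\<And>p q. P p \<Longrightarrow> P (p * q)"
    and "\<And>x y. P (letter (x + y) - (letter x + letter y))"
    and "\<And>c x. P (letter (s c x) - const c * letter x)"
    and "\<And>x y. P (letter x * letter y - letter y * letter x - letter (b x y))"
  shows "P p"
proof -
  have "ideal {p. P p} free_alg"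
    by (rule ideal_free_algI) (use zero add left right in auto)
  moreover have "uea_relations s b \<subseteq> {p. P p}"
    using assms(6-8) by (auto simp: uea_relations_def)
  ultimately show ?thesis
    using ring.genideal_minimal[OF ring_free_alg, of "{p. P p}"] assms(1)
    by (auto simp: uea_ideal_def)
qed

section \<open>Arithmetic of cosets\<close>

lemma uea_class_eq_iff: "uea_class s b p = uea_class s b q \<longleftrightarrow> p - q \<in> uea_ideal s b"
proof
  have eq: "uea_class s b p = {i + p | i. i \<in> uea_ideal s b}" for p
    by (auto simp: uea_class_def a_r_coset_def r_coset_def free_alg_def)
  show "p - q \<in> uea_ideal s b" if "uea_class s b p = uea_class s b q"
  proof -
    have "p \<in> uea_class s b p"
      unfolding eq using uea_ideal_0[of s b] by force
    then have "p \<in> uea_class s b q" using that by simp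
    then show ?thesis by (auto simp: eq)
  qed
  have sub: "uea_class s b p \<subseteq> uea_class s b q" if "p - q \<in> uea_ideal s b" for p q
  proof
    fix r assume "r \<in> uea_class s b p"
    then obtain i where i: "i \<in> uea_ideal s b" "r = i + p" by (auto simp: eq)
    then have "r = (i + (p - q)) + q" by simp
    with uea_ideal_add[OF i(1) that] show "r \<in> uea_class s b q" unfolding eq by blast
  qed
  show "uea_class s b p = uea_class s b q" if "p - q \<in> uea_ideal s b"
    using sub[OF that] sub[of q p] uea_ideal_uminus[OF that] by auto
qed

lemma carrier_uea: "carrier (uea s b) = range (uea_class s b)"
  by (auto simp: uea_def uea_class_def FactRing_def A_RCOSETS_def RCOSETS_def a_r_coset_def free_alg_def)

lemma uea_class_in_carrier [simp]: "uea_class s b p \<in> carrier (uea s b)"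
  by (simp add: carrier_uea)

lemma uea_add: "uea_class s b p \<oplus>\<^bsub>uea s b\<^esub> uea_class s b q = uea_class s b (p + q)"
proof -
  interpret ideal "uea_ideal s b" free_alg by (rule ideal_uea_ideal)
  show ?thesis
    using a_rcos_sum[of p q] by (simp add: uea_def FactRing_def uea_class_def free_alg_def)
qed

lemma uea_mult: "uea_class s b p \<otimes>\<^bsub>uea s b\<^esub> uea_class s b q = uea_class s b (p * q)"
proof -
  interpret ideal "uea_ideal s b" free_alg by (rule ideal_uea_ideal)
  show ?thesis
    using rcoset_mult_add[of p q] by (simp add: uea_def FactRing_def uea_class_def free_alg_def)
qed

lemma uea_smult: "c \<odot>\<^bsub>uea s b\<^esub> uea_class s b p = uea_class s b (const c * p)"
proof -
  have "c \<odot>\<^bsub>uea s b\<^esub> u = uea_class s b (const c) \<otimes>\<^bsub>uea s b\<^esub> u" for u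
    by (simp add: uea_def Let_def)
  then show ?thesis by (simp add: uea_mult)
qed

lemma uea_one: "\<one>\<^bsub>uea s b\<^esub> = uea_class s b 1"
  by (simp add: uea_def FactRing_def uea_class_def) (simp add: free_alg_def)

lemma uea_zero: "\<zero>\<^bsub>uea s b\<^esub> = uea_class s b 0"
proof -
  have "\<zero>\<^bsub>uea s b\<^esub> = uea_ideal s b"
    by (simp add: uea_def FactRing_def)
  then show ?thesis
    by (auto simp: uea_class_def a_r_coset_def r_coset_def free_alg_def)
qed

lemmas uea_simps = uea_add uea_mult uea_smult uea_one uea_zero

lemma abelian_monoid_uea: "abelian_monoid (uea s b)"
  by (rule abelian_monoidI) (auto simp: carrier_uea uea_add uea_zero add_ac)

lemma uea_finsum:
  "finite A \<Longrightarrow> (\<Oplus>\<^bsub>uea s b\<^esub>a\<in>A. uea_class s b (f a)) = uea_class s b (sum f A)"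
proof (induction A rule: finite_induct)
  case empty
  then show ?case by (simp add: abelian_monoid.finsum_empty[OF abelian_monoid_uea] uea_zero)
next
  case (insert a A)
  then show ?case
    by (subst abelian_monoid.finsum_insert[OF abelian_monoid_uea]) (auto simp: uea_add)
qed

section \<open>The operators of the action on the free algebra\<close>

lemma (in lie_algebra) bracket_sum_left:
  "bracket (sum f A) x = (\<Sum>a\<in>A. bracket (f a) x)"
proof (induction A rule: infinite_finite_induct)
  case empty
  show ?case using bracket_add_left[of 0 0 x] by simp
qed (use bracket_add_left[of 0 0 x] in \<open>simp_all add: bracket_add_left\<close>)

locale based_lie_algebra = lie_algebra scale bracket
  for scale :: "'k::field \<Rightarrow> 'g::ab_group_add \<Rightarrow> 'g" and bracket :: "'g \<Rightarrow> 'g \<Rightarrow> 'g" +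
  fixes X :: "'n::finite \<Rightarrow> 'g" and C :: "'n \<Rightarrow> 'n \<Rightarrow> 'n \<Rightarrow> 'k"
  assumes basis: "indexed_basis X"
    and structure_eq: "bracket (X \<mu>) (X \<nu>) = (\<Sum>\<alpha>\<in>UNIV. scale (C \<mu> \<nu> \<alpha>) (X \<alpha>))"
begin

abbreviation "U \<equiv> uea scale bracket"
abbreviation "UL \<equiv> uea (*s) (gL_bracket C)"
abbreviation "I \<equiv> uea_ideal scale bracket"
abbreviation "IL \<equiv> uea_ideal (*s) (gL_bracket C)"
abbreviation "cls \<equiv> uea_class scale bracket"
abbreviation "clsL \<equiv> uea_class (*s) (gL_bracket C)"

section \<open>Coordinates and the matrices of right bracketing\<close>

definition coord :: "'n \<Rightarrow> 'g \<Rightarrow> 'k" where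
  "coord \<alpha> y = representation (range X) y (X \<alpha>)"

lemma basis_facts: "inj X" "independent (range X)" "y \<in> span (range X)"
  using basis by (auto simp: indexed_basis_def)

lemma coord_add: "coord \<alpha> (x + y) = coord \<alpha> x + coord \<alpha> y"
  by (simp add: coord_def representation_add basis_facts)

lemma coord_scale: "coord \<alpha> (scale c x) = c * coord \<alpha> x"
  by (simp add: coord_def representation_scale basis_facts)

lemma coord_X: "coord \<alpha> (X \<mu>) = (if \<mu> = \<alpha> then 1 else 0)"
  using basis_facts(1) by (auto simp: coord_def representation_basis basis_facts inj_eq)

lemma coord_0: "coord \<alpha> 0 = 0"
  using coord_scale[of \<alpha> 0 0] by simp

lemma coord_diff: "coord \<alpha> (x - y) = coord \<alpha> x - coord \<alpha> y"
  using coord_add[of \<alpha> "x - y" y] by simp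

lemma coord_sum: "coord \<alpha> (sum f A) = (\<Sum>a\<in>A. coord \<alpha> (f a))"
  by (induction A rule: infinite_finite_induct) (simp_all add: coord_0 coord_add)

lemma basis_expansion_X: "(\<Sum>\<alpha>\<in>UNIV. scale (coord \<alpha> y) (X \<alpha>)) = y"
proof -
  have "(\<Sum>v\<in>range X. scale (representation (range X) y v) v) = y"
    by (rule sum_representation_eq) (use basis_facts in auto)
  then show ?thesis by (simp add: sum.reindex basis_facts coord_def)
qed

text \<open>The matrix of the map [., x] in the basis \<open>X\<close>, with row \<mu> holding the
  coordinates of [X_\<mu>, x].\<close>

definition rad :: "'g \<Rightarrow> 'n \<Rightarrow> 'n \<Rightarrow> 'k" where
  "rad x \<mu> \<alpha> = coord \<alpha> (bracket (X \<mu>) x)"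

lemma rad_add: "rad (x + y) \<mu> \<alpha> = rad x \<mu> \<alpha> + rad y \<mu> \<alpha>"
  by (simp add: rad_def bracket_add_right coord_add)

lemma rad_scale: "rad (scale c x) \<mu> \<alpha> = c * rad x \<mu> \<alpha>"
  by (simp add: rad_def bracket_scale_right coord_scale)

lemma rad_X: "rad (X \<kappa>) \<mu> \<alpha> = C \<mu> \<kappa> \<alpha>"
  by (simp add: rad_def structure_eq coord_sum coord_scale coord_X if_distrib cong: if_cong)

text \<open>By the Jacobi identity, [z, [x, y]] = [[z, x], y] - [[z, y], x]. With images stored in
  rows, bracketing first with x and then with y has matrix \<open>rad x\<close> times
  \<open>rad y\<close>, so \<open>rad\<close> is a representation by matrices.\<close>

lemma rad_bracket:
  "rad (bracket x y) \<mu> \<nu> = (\<Sum>\<alpha>\<in>UNIV. rad x \<mu> \<alpha> * rad y \<alpha> \<nu>) - (\<Sum>\<alpha>\<in>UNIV. rad y \<mu> \<alpha> * rad x \<alpha> \<nu>)"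
proof -
  have *: "coord \<nu> (bracket (bracket (X \<mu>) x) y) = (\<Sum>\<alpha>\<in>UNIV. rad x \<mu> \<alpha> * rad y \<alpha> \<nu>)" for x y
  proof -
    have "bracket (bracket (X \<mu>) x) y
        = bracket (\<Sum>\<alpha>\<in>UNIV. scale (rad x \<mu> \<alpha>) (X \<alpha>)) y"
      by (simp add: rad_def basis_expansion_X)
    then show ?thesis
      by (simp add: bracket_sum_left bracket_scale_left coord_sum coord_scale rad_def)
  qed
  have "bracket (X \<mu>) (bracket x y) = - bracket x (bracket y (X \<mu>)) - bracket y (bracket (X \<mu>) x)"
    using jacobi[of "X \<mu>" x y] by (metis add_diff_cancel_right' diff_0 minus_diff_commute)
  also have "\<dots> = bracket (bracket (X \<mu>) x) y - bracket (bracket (X \<mu>) y) x"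
    using bracket_antisym[of "bracket (X \<mu>) x" y] bracket_antisym[of "bracket (X \<mu>) y" x]
      bracket_antisym[of y "X \<mu>"] bracket_scale_right[of x "-1" "bracket (X \<mu>) y"]
    by simp
  finally show ?thesis
    by (simp add: rad_def[of "bracket x y"] coord_diff *)
qed

text \<open>
  \<open>T \<mu> \<nu> p\<close> is the \<open>(\<mu>, \<nu>)\<close> entry of the image of \<open>p\<close> under the algebra homomorphism into
  matrices over the free algebra that sends \<open>x\<close> to \<open>x\<close> times the identity plus \<open>rad x\<close>.
\<close>

primrec T_word :: "'g list \<Rightarrow> 'n \<Rightarrow> 'n \<Rightarrow> ('g, 'k) free_alg" where
  "T_word [] \<mu> \<nu> = (if \<mu> = \<nu> then 1 else 0)"
| "T_word (x # w) \<mu> \<nu> =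
     letter x * T_word w \<mu> \<nu> + (\<Sum>\<alpha>\<in>UNIV. const (rad x \<mu> \<alpha>) * T_word w \<alpha> \<nu>)"

definition T :: "'n \<Rightarrow> 'n \<Rightarrow> ('g, 'k) free_alg \<Rightarrow> ('g, 'k) free_alg" where
  "T \<mu> \<nu> = lin_ext (case_free_monoid (\<lambda>w. T_word w \<mu> \<nu>))"

section \<open>Product rule, stability of the ideal, and commutation of the operators
  \<open>T\<close>\<close>

lemma T_add: "T \<mu> \<nu> (p + q) = T \<mu> \<nu> p + T \<mu> \<nu> q"
  and T_diff: "T \<mu> \<nu> (p - q) = T \<mu> \<nu> p - T \<mu> \<nu> q"
  and T_0: "T \<mu> \<nu> 0 = 0"
  and T_const_mult: "T \<mu> \<nu> (const c * p) = const c * T \<mu> \<nu> p"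
  and T_one: "T \<mu> \<nu> 1 = (if \<mu> = \<nu> then 1 else 0)"
  by (simp_all add: T_def lin_ext_add lin_ext_diff lin_ext_const_mult lin_ext_one)

lemma T_sum: "T \<mu> \<nu> (sum f A) = (\<Sum>a\<in>A. T \<mu> \<nu> (f a))"
  by (induction A rule: infinite_finite_induct) (simp_all add: T_0 T_add)

lemma T_letter_mult:
  "T \<mu> \<nu> (letter x * p) = letter x * T \<mu> \<nu> p + (\<Sum>\<alpha>\<in>UNIV. const (rad x \<mu> \<alpha>) * T \<alpha> \<nu> p)"
proof (induction p rule: poly_mapping_single_induct)
  case (single k c)
  obtain w where "k = Word w" by (cases k)
  then show ?case
    by (simp add: T_def letter_mult_single distrib_left sum_distrib_left const_letter_ac)
qed (simp add: T_add distrib_left sum.distrib algebra_simps)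

text \<open>A letter x in front multiplies the matrix of \<open>T\<close> values on the left by x
  times the identity plus \<open>rad x\<close>. The induction step is therefore associativity of
  matrix multiplication; it mixes the rows, so \<mu> must vary.\<close>

lemma T_mult: "T \<mu> \<nu> (p * q) = (\<Sum>\<alpha>\<in>UNIV. T \<mu> \<alpha> p * T \<alpha> \<nu> q)"
proof (induction p arbitrary: \<mu> rule: free_alg_induct)
  case one
  then show ?case by (simp add: T_one if_distrib if_distribR cong: if_cong)
next
  case (letter x p)
  have "T \<mu> \<nu> (letter x * p * q) = letter x * (\<Sum>\<beta>\<in>UNIV. T \<mu> \<beta> p * T \<beta> \<nu> q)
      + (\<Sum>\<alpha>\<in>UNIV. const (rad x \<mu> \<alpha>) * (\<Sum>\<beta>\<in>UNIV. T \<alpha> \<beta> p * T \<beta> \<nu> q))"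
    by (simp add: mult.assoc T_letter_mult letter)
  also have "\<dots> = (\<Sum>\<beta>\<in>UNIV. letter x * (T \<mu> \<beta> p * T \<beta> \<nu> q))
      + (\<Sum>\<beta>\<in>UNIV. \<Sum>\<alpha>\<in>UNIV. const (rad x \<mu> \<alpha>) * (T \<alpha> \<beta> p * T \<beta> \<nu> q))"
    unfolding sum_distrib_left by (subst (2) sum.swap) (rule refl)
  also have "\<dots> = (\<Sum>\<beta>\<in>UNIV. T \<mu> \<beta> (letter x * p) * T \<beta> \<nu> q)"
    by (simp add: T_letter_mult distrib_right sum.distrib sum_distrib_right mult.assoc)
  finally show ?case .
qed (simp_all add: mult.assoc T_const_mult T_add sum_distrib_left distrib_right sum.distrib)

lemma T_letter: "T \<mu> \<nu> (letter x) = (if \<mu> = \<nu> then letter x else 0) + const (rad x \<mu> \<nu>)"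
  using T_letter_mult[of \<mu> \<nu> x 1]
  by (simp add: T_one if_distrib if_distribR cong: if_cong)

text \<open>On each defining relation the matrix of \<open>T\<close> values is the relation times
  the identity, since the \<open>rad\<close> terms cancel. The product rule then carries membership
  through two-sided multiplication.\<close>

lemma T_ideal: "p \<in> I \<Longrightarrow> T \<mu> \<nu> p \<in> I"
proof (induction p arbitrary: \<mu> \<nu> rule: uea_ideal_induct)
  case (Add x y)
  have "T \<mu> \<nu> (letter (x + y) - (letter x + letter y))
      = (if \<mu> = \<nu> then letter (x + y) - (letter x + letter y) else 0)"
    by (simp add: T_diff T_add T_letter rad_add const_add)
  then show ?case by (simp add: uea_ideal_letter_add uea_ideal_0)
next
  case (Scale c x)
  have "T \<mu> \<nu> (letter (scale c x) - const c * letter x)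
      = (if \<mu> = \<nu> then letter (scale c x) - const c * letter x else 0)"
    by (simp add: T_diff T_const_mult T_letter rad_scale const_mult algebra_simps)
  then show ?case by (simp add: uea_ideal_letter_scale uea_ideal_0)
next
  case (Bracket x y)
  \<comment> \<open>The two mixed terms together are symmetric in x and y, so they drop out of the
    commutator. The remaining scalar is the one given by \<open>rad_bracket\<close>.\<close>
  have *: "T \<mu> \<nu> (letter x * letter y) = (if \<mu> = \<nu> then letter x * letter y else 0)
      + const (rad y \<mu> \<nu>) * letter x + const (rad x \<mu> \<nu>) * letter y
      + const (\<Sum>\<alpha>\<in>UNIV. rad x \<mu> \<alpha> * rad y \<alpha> \<nu>)" for x y
    by (simp add: T_letter_mult T_letter distrib_left sum.distrib const_letter_ac const_sum const_mult
        if_distrib[of "(*) (const _)"] add.assoc cong: if_cong)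
  have "T \<mu> \<nu> (letter x * letter y - letter y * letter x - letter (bracket x y))
      = (if \<mu> = \<nu> then letter x * letter y - letter y * letter x - letter (bracket x y) else 0)"
    by (simp add: T_diff * T_letter rad_bracket const_diff)
  then show ?case by (simp add: uea_ideal_letter_bracket uea_ideal_0)
qed (auto simp: T_0 T_add T_mult uea_ideal_0
    intro!: uea_ideal_add uea_ideal_sum intro: uea_ideal_mult_left uea_ideal_mult_right)

text \<open>In either order, a leading letter x yields x times both operators, plus terms in which
  \<open>rad x\<close> replaces the first index of one of the two operators. The induction
  hypothesis, for all indices, matches these term by term.\<close>

lemma T_commute: "T \<mu> \<nu> (T \<alpha> \<beta> p) = T \<alpha> \<beta> (T \<mu> \<nu> p)"
proof (induction p arbitrary: \<mu> \<nu> \<alpha> \<beta> rule: free_alg_induct)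
  case one
  then show ?case by (simp add: T_one T_0)
next
  case (letter x p)
  then show ?case
    by (simp add: T_letter_mult T_add T_sum T_const_mult algebra_simps)
qed (simp_all add: T_add T_const_mult)

section \<open>Operators for the elements of g^L and their commutators\<close>

fun basis_op :: "'n + 'n \<times> 'n \<Rightarrow> ('g, 'k) free_alg \<Rightarrow> ('g, 'k) free_alg" where
  "basis_op (Inl \<mu>) p = letter (X \<mu>) * p"
| "basis_op (Inr (\<mu>, \<nu>)) p = T \<mu> \<nu> p"

lemma basis_op_add: "basis_op i (p + q) = basis_op i p + basis_op i q"
  and basis_op_0: "basis_op i 0 = 0"
  and basis_op_const_mult: "basis_op i (const c * p) = const c * basis_op i p"
  and basis_op_ideal: "p \<in> I \<Longrightarrow> basis_op i p \<in> I"
proof -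
  show "basis_op i (p + q) = basis_op i p + basis_op i q"
    by (cases "(i, p)" rule: basis_op.cases) (simp_all add: T_add distrib_left)
  show "basis_op i 0 = 0"
    by (cases "(i, p)" rule: basis_op.cases) (simp_all add: T_0)
  show "basis_op i (const c * p) = const c * basis_op i p"
    by (cases "(i, p)" rule: basis_op.cases) (simp_all add: T_const_mult const_letter_ac)
  show "p \<in> I \<Longrightarrow> basis_op i p \<in> I"
    by (cases "(i, p)" rule: basis_op.cases) (simp_all add: T_ideal uea_ideal_mult_left)
qed

lemma basis_op_sum: "basis_op i (sum f A) = (\<Sum>a\<in>A. basis_op i (f a))"
  by (induction A rule: infinite_finite_induct) (simp_all add: basis_op_0 basis_op_add)

definition gL_op :: "('k, 'n) gL \<Rightarrow> ('g, 'k) free_alg \<Rightarrow> ('g, 'k) free_alg" where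
  "gL_op u p = (\<Sum>i\<in>UNIV. const (u $ i) * basis_op i p)"

lemma gL_op_axis: "gL_op (axis i 1) p = basis_op i p"
proof -
  have "const (axis i 1 $ j) * basis_op j p = (if j = i then basis_op i p else 0)" for j
    by (simp add: axis_def)
  then show ?thesis by (simp add: gL_op_def)
qed

lemma gL_op_X: "gL_op (gL_X \<mu>) p = letter (X \<mu>) * p"
  and gL_op_T: "gL_op (gL_T \<mu> \<nu>) p = T \<mu> \<nu> p"
  by (simp_all add: gL_X_def gL_T_def gL_op_axis)

lemma gL_op_add: "gL_op u (p + q) = gL_op u p + gL_op u q"
  and gL_op_const_mult: "gL_op u (const c * p) = const c * gL_op u p"
  by (simp_all add: gL_op_def basis_op_add basis_op_const_mult distrib_left sum.distrib
      sum_distrib_left const_letter_ac)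

lemma gL_op_ideal: "p \<in> I \<Longrightarrow> gL_op u p \<in> I"
  unfolding gL_op_def by (intro uea_ideal_sum uea_ideal_mult_left basis_op_ideal)

lemma gL_op_vec_add: "gL_op (u + v) p = gL_op u p + gL_op v p"
  and gL_op_vec_scale: "gL_op (c *s u) p = const c * gL_op u p"
  and gL_op_vec_0: "gL_op 0 p = 0"
  and gL_op_vec_uminus: "gL_op (- u) p = - gL_op u p"
  by (simp_all add: gL_op_def const_add const_mult const_uminus distrib_right sum.distrib
      sum_distrib_left mult.assoc sum_negf)

lemma gL_op_vec_sum: "gL_op (sum f A) p = (\<Sum>a\<in>A. gL_op (f a) p)"
  by (induction A rule: infinite_finite_induct) (simp_all add: gL_op_vec_0 gL_op_vec_add)

text \<open>Two \<open>T\<close> operators commute, and a \<open>T\<close> with an X follows the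
  recursion for \<open>T\<close>, both exactly in the free algebra. Only for two X does the
  commutator relation of U(g) enter, hence membership in \<open>I\<close> in place of
  equality.\<close>

lemma basis_op_bracket:
  "basis_op i (basis_op j p) - basis_op j (basis_op i p) - gL_op (gL_basis_bracket C i j) p \<in> I"
proof -
  have XX: "letter (X \<mu>) * (letter (X \<nu>) * p) - letter (X \<nu>) * (letter (X \<mu>) * p)
      - (\<Sum>\<alpha>\<in>UNIV. const (C \<mu> \<nu> \<alpha>) * (letter (X \<alpha>) * p)) \<in> I" for \<mu> \<nu>
  proof -
    have "letter (X \<mu>) * (letter (X \<nu>) * p) - letter (X \<nu>) * (letter (X \<mu>) * p)
        - (\<Sum>\<alpha>\<in>UNIV. const (C \<mu> \<nu> \<alpha>) * (letter (X \<alpha>) * p))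
      = (letter (X \<mu>) * letter (X \<nu>) - letter (X \<nu>) * letter (X \<mu>)
          - letter (bracket (X \<mu>) (X \<nu>))
        + (letter (\<Sum>\<alpha>\<in>UNIV. scale (C \<mu> \<nu> \<alpha>) (X \<alpha>))
          - (\<Sum>\<alpha>\<in>UNIV. const (C \<mu> \<nu> \<alpha>) * letter (X \<alpha>)))) * p"
      by (simp add: structure_eq left_diff_distrib distrib_right sum_distrib_right mult.assoc)
    also have "\<dots> \<in> I"
      by (intro uea_ideal_mult_right uea_ideal_add uea_ideal_letter_bracket uea_ideal_letter_sum)
    finally show ?thesis .
  qed
  have TX: "T \<mu> \<nu> (letter (X \<kappa>) * p) = letter (X \<kappa>) * T \<mu> \<nu> p
      + gL_op (\<Sum>\<alpha>\<in>UNIV. C \<mu> \<kappa> \<alpha> *s gL_T \<alpha> \<nu>) p" for \<mu> \<nu> \<kappa>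
    by (simp add: T_letter_mult rad_X gL_op_vec_sum gL_op_vec_scale gL_op_T)
  show ?thesis
    by (cases "(C, i, j)" rule: gL_basis_bracket.cases)
      (simp_all add: XX TX T_commute gL_op_vec_sum[of "\<lambda>a. C _ _ a *s gL_X a"] gL_op_vec_scale
        gL_op_X gL_op_vec_0 gL_op_vec_uminus uea_ideal_0)
qed

text \<open>Bilinearity in u and v reduces the commutation rule to basis vectors.\<close>

lemma gL_op_bracket:
  "gL_op u (gL_op v p) - gL_op v (gL_op u p) - gL_op (gL_bracket C u v) p \<in> I"
proof -
  have *: "gL_op u (gL_op v p)
      = (\<Sum>i\<in>UNIV. \<Sum>j\<in>UNIV. const (u $ i * v $ j) * basis_op i (basis_op j p))" for u v
    by (simp add: gL_op_def basis_op_sum basis_op_const_mult const_mult sum_distrib_left mult.assoc)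
  have **: "gL_op v (gL_op u p)
      = (\<Sum>i\<in>UNIV. \<Sum>j\<in>UNIV. const (u $ i * v $ j) * basis_op j (basis_op i p))"
    unfolding *[of v u] by (subst sum.swap) (simp add: mult.commute)
  have "gL_op u (gL_op v p) - gL_op v (gL_op u p) - gL_op (gL_bracket C u v) p
      = (\<Sum>i\<in>UNIV. \<Sum>j\<in>UNIV. const (u $ i * v $ j) * (basis_op i (basis_op j p)
          - basis_op j (basis_op i p) - gL_op (gL_basis_bracket C i j) p))"
    unfolding *[of u v] **
    by (simp add: gL_bracket_def gL_op_vec_sum gL_op_vec_scale right_diff_distrib sum_subtractf)
  also have "\<dots> \<in> I"
    by (intro uea_ideal_sum uea_ideal_mult_left basis_op_bracket)
  finally show ?thesis .
qed

section \<open>Words in g^L acting on the free algebra over g\<close>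

definition word_act :: "(('k, 'n) gL, 'k) free_alg \<Rightarrow> ('g, 'k) free_alg \<Rightarrow> ('g, 'k) free_alg" where
  "word_act p x = lin_ext (case_free_monoid (\<lambda>w. foldr gL_op w x)) p"

lemma word_act_add: "word_act (p + q) x = word_act p x + word_act q x"
  and word_act_diff: "word_act (p - q) x = word_act p x - word_act q x"
  and word_act_0: "word_act 0 x = 0"
  and word_act_const_mult: "word_act (const c * p) x = const c * word_act p x"
  and word_act_one: "word_act 1 x = x"
  and word_act_const: "word_act (const c) x = const c * x"
  and word_act_letter: "word_act (letter u) x = gL_op u x"
  by (simp_all add: word_act_def lin_ext_add lin_ext_diff lin_ext_const_mult lin_ext_one lin_ext_letter)
    (simp add: const_def zero_free_monoid_def)

lemma word_act_letter_mult: "word_act (letter u * p) x = gL_op u (word_act p x)"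
proof (induction p rule: poly_mapping_single_induct)
  case (single k c)
  obtain w where "k = Word w" by (cases k)
  then show ?case by (simp add: word_act_def letter_mult_single gL_op_const_mult)
qed (simp add: word_act_add distrib_left gL_op_add)

text \<open>\<open>foldr\<close> lets the rightmost letter act first, so concatenation of words
  becomes composition of operators.\<close>

lemma word_act_mult: "word_act (p * q) x = word_act p (word_act q x)"
  by (induction p rule: free_alg_induct)
    (simp_all add: mult.assoc word_act_one word_act_letter_mult word_act_const_mult word_act_add distrib_right)

lemma word_act_add_right: "word_act p (x + y) = word_act p x + word_act p y"
  by (induction p rule: free_alg_induct)
    (simp_all add: word_act_one word_act_letter_mult word_act_const_mult word_act_add gL_op_add distrib_left add_ac)

lemma word_act_diff_right: "word_act p (x - y) = word_act p x - word_act p y"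
  using word_act_add_right[of p "x - y" y] by simp

lemma word_act_const_mult_right: "word_act p (const c * x) = const c * word_act p x"
  by (induction p rule: free_alg_induct)
    (simp_all add: word_act_one word_act_letter_mult word_act_const_mult word_act_add gL_op_const_mult distrib_left const_letter_ac)

lemma word_act_ideal_right: "x \<in> I \<Longrightarrow> word_act p x \<in> I"
  by (induction p rule: free_alg_induct)
    (simp_all add: word_act_one word_act_letter_mult word_act_const_mult word_act_add gL_op_ideal uea_ideal_mult_left uea_ideal_add)

text \<open>The linear relations act as zero, and the bracket relations map into \<open>I\<close> by
  \<open>gL_op_bracket\<close>. A left factor preserves \<open>I\<close>; a right factor only
  changes the argument x, which is kept arbitrary.\<close>

lemma word_act_ideal_left: "p \<in> IL \<Longrightarrow> word_act p x \<in> I"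
proof (induction p arbitrary: x rule: uea_ideal_induct)
  case (Bracket u v)
  then show ?case using gL_op_bracket by (simp add: word_act_diff word_act_letter_mult word_act_letter)
qed (simp_all add: word_act_0 word_act_add word_act_diff word_act_mult word_act_letter gL_op_vec_add gL_op_vec_scale word_act_const
    word_act_ideal_right uea_ideal_0 uea_ideal_add)

lemma word_act_cong:
  assumes "clsL p = clsL q" "cls x = cls y"
  shows "cls (word_act p x) = cls (word_act q y)"
proof -
  have "word_act p x - word_act q y = word_act (p - q) x + word_act q (x - y)"
    by (simp add: word_act_diff word_act_diff_right)
  then show ?thesis
    using assms by (simp add: uea_class_eq_iff word_act_ideal_left word_act_ideal_right uea_ideal_add)
qed

section \<open>Descent to the enveloping algebras\<close>

text \<open>The pairs (p, x) on which \<open>act\<close> is forced to agree with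
  \<open>word_act\<close> are closed under linear combinations on both sides, under composition, and
  under congruence modulo the ideals. It remains to reach the letters of g^L, and the hard ones are
  the T_\<mu>\<nu>, whose value is prescribed only on 1.\<close>

lemma triangle_map_cls:
  assumes "triangle_map scale bracket X C act"
  shows "act (clsL p) (cls x) = cls (word_act p x)"
proof -
  define P where "P p x \<longleftrightarrow> act (clsL p) (cls x) = cls (word_act p x)" for p x
  have bil: "bilinear_map UL U U act"
    using assms by (simp add: triangle_map_def Let_def)
  have mult: "act (clsL (p * q)) (cls x) = act (clsL p) (act (clsL q) (cls x))" for p q x
    using assms unfolding triangle_map_def Let_def
    by (simp flip: uea_mult)
  have P_one: "P 1 x" for x
    using assms by (auto simp: P_def word_act_one triangle_map_def Let_def uea_one)
  have P_X: "P (letter (gL_X \<mu>)) x" for \<mu> x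
    using assms
    by (auto simp: P_def word_act_letter gL_op_X triangle_map_def Let_def uea_incl_def uea_mult)
  have P_T_one: "P (letter (gL_T \<mu> \<nu>)) 1" for \<mu> \<nu>
    using assms
    by (auto simp: P_def word_act_letter gL_op_T T_one triangle_map_def Let_def uea_incl_def uea_one uea_zero)
  have P_mult: "P (p * q) x" if "P q x" "P p (word_act q x)" for p q x
    using that by (simp add: P_def mult word_act_mult)
  have P_mult_right: "P p (word_act q x)" if "P q x" "P (p * q) x" for p q x
    using that by (simp add: P_def mult word_act_mult)
  have P_add_left: "P (p + q) x" if "P p x" "P q x" for p q x
    using that bil unfolding P_def bilinear_map_def by (simp add: word_act_add flip: uea_add)
  have P_add_right: "P p (x + y)" if "P p x" "P p y" for p x y
    using that bil unfolding P_def bilinear_map_def by (simp add: word_act_add_right flip: uea_add)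
  have P_const_left: "P (const c * p) x" if "P p x" for c p x
    using that bil unfolding P_def bilinear_map_def by (simp add: word_act_const_mult flip: uea_smult)
  have P_const_right: "P p (const c * x)" if "P p x" for c p x
    using that bil unfolding P_def bilinear_map_def
    by (simp add: word_act_const_mult_right flip: uea_smult)
  have P_cong_left: "P p x" if "p - q \<in> IL" "P q x" for p q x
  proof -
    have "clsL p = clsL q" using that by (simp add: uea_class_eq_iff)
    then show ?thesis using that word_act_cong[of p q x x] by (simp add: P_def)
  qed
  have P_cong_right: "P p x" if "x - y \<in> I" "P p y" for p x y
  proof -
    have "cls x = cls y" using that by (simp add: uea_class_eq_iff)
    then show ?thesis using that word_act_cong[of p p x y] by (simp add: P_def)
  qed
  have P_sum_left: "P (sum f S) x" if "\<And>a. P (f a) x" for f :: "'z \<Rightarrow> _" and S x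
    by (induction S rule: infinite_finite_induct)
      (use that P_add_left P_const_left[OF P_one, of 0] in simp_all)
  \<comment> \<open>Scaling by 0 gives the zero class once the value of \<open>act\<close> is known
    to be a class, which bilinearity on the carriers provides.\<close>
  have P_0_right: "P p 0" for p
  proof -
    have "act (clsL p) (0 \<odot>\<^bsub>U\<^esub> cls 0) = 0 \<odot>\<^bsub>U\<^esub> act (clsL p) (cls 0)"
      "act (clsL p) (cls 0) \<in> range cls"
      using bil by (simp_all add: bilinear_map_def flip: carrier_uea)
    moreover have "word_act p 0 = 0"
      using word_act_diff_right[of p 0 0] by simp
    ultimately show ?thesis by (auto simp: P_def uea_smult)
  qed
  have P_sum_right: "P p (sum f S)" if "\<And>a. P p (f a)" for f :: "'z \<Rightarrow> _" and S p
    by (induction S rule: infinite_finite_induct) (use that P_add_right P_0_right in simp_all)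
  \<comment> \<open>Moving T_\<mu>\<nu> past X_\<kappa> produces T_\<alpha>\<nu> for other \<alpha>,
    so the induction on x needs all indices at once.\<close>
  have P_T: "P (letter (gL_T \<mu> \<nu>)) x" for \<mu> \<nu> x
  proof (induction x arbitrary: \<mu> \<nu> rule: free_alg_induct)
    case (letter y p)
    have TX: "P (letter (gL_T \<mu> \<nu>)) (letter (X \<kappa>) * p)" for \<kappa>
    proof -
      let ?T = "letter (gL_T \<mu> \<nu>)" and ?X = "letter (gL_X \<kappa>)"
      let ?S = "\<Sum>\<alpha>\<in>UNIV. const (C \<mu> \<kappa> \<alpha>) * letter (gL_T \<alpha> \<nu>)"
      \<comment> \<open>Modulo \<open>IL\<close>, \<open>?T * ?X\<close> is
        \<open>?X * ?T + ?S\<close>, in which every T acts directly on the shorter p. Agreement for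
        the product \<open>?T * ?X\<close> on p then yields agreement for \<open>?T\<close> on
        X_\<kappa> p.\<close>
      have "?T * ?X - ?X * ?T - letter (gL_bracket C (gL_T \<mu> \<nu>) (gL_X \<kappa>))
          + (letter (\<Sum>\<alpha>\<in>UNIV. C \<mu> \<kappa> \<alpha> *s gL_T \<alpha> \<nu>) - ?S) \<in> IL"
        by (intro uea_ideal_add uea_ideal_letter_bracket uea_ideal_letter_sum)
      then have "?T * ?X - (?X * ?T + ?S) \<in> IL"
        by (simp add: gL_brackets algebra_simps)
      moreover have "P (?X * ?T + ?S) p"
        by (intro P_add_left P_mult P_sum_left P_const_left P_X letter)
      ultimately have "P ?T (word_act ?X p)"
        by (intro P_mult_right P_X) (rule P_cong_left)
      then show ?thesis by (simp add: word_act_letter gL_op_X)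
    qed
    \<comment> \<open>A letter y is an arbitrary element of g, whereas the step above covers basis
      vectors; the two are linked by expanding y modulo \<open>I\<close>.\<close>
    have "(letter (\<Sum>\<alpha>\<in>UNIV. scale (coord \<alpha> y) (X \<alpha>))
        - (\<Sum>\<alpha>\<in>UNIV. const (coord \<alpha> y) * letter (X \<alpha>))) * p \<in> I"
      by (intro uea_ideal_mult_right uea_ideal_letter_sum)
    then have "letter y * p - (\<Sum>\<alpha>\<in>UNIV. const (coord \<alpha> y) * (letter (X \<alpha>) * p)) \<in> I"
      by (simp add: basis_expansion_X left_diff_distrib sum_distrib_right mult.assoc)
    then show ?case
      by (rule P_cong_right) (intro P_sum_right P_const_right TX)
  qed (intro P_T_one P_const_right P_add_right; assumption)+
  have P_letter: "P (letter u) x" for u x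
  proof (rule P_cong_left)
    show "letter u - (\<Sum>i\<in>UNIV. const (u $ i) * letter (axis i 1)) \<in> IL"
      using uea_ideal_letter_sum[of "(*s)" "\<lambda>i. u $ i" "\<lambda>i. axis i 1" UNIV "gL_bracket C"]
      by (simp add: basis_expansion)
    have "P (letter (axis i 1)) x" for i
      using P_X[of _ x] P_T[of _ _ x] by (cases i) (auto simp: gL_X_def gL_T_def)
    then show "P (\<Sum>i\<in>UNIV. const (u $ i) * letter (axis i 1)) x"
      by (intro P_sum_left P_const_left)
  qed
  have "P p x"
  proof (induction p rule: free_alg_induct)
    case (letter u p)
    then show ?case by (intro P_mult P_letter)
  qed (auto intro: P_one P_const_left P_add_left)
  then show ?thesis by (simp add: P_def)
qed

section \<open>Existence, uniqueness and the product rule on the quotients\<close>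

definition act_map where
  "act_map = (\<lambda>a\<in>carrier UL. \<lambda>x\<in>carrier U. cls (word_act (inv_into UNIV clsL a) (inv_into UNIV cls x)))"

text \<open>The representatives chosen by \<open>inv_into\<close> do not matter, by
  \<open>word_act_cong\<close>. This is the well-definedness of the action.\<close>

lemma act_map_cls: "act_map (clsL p) (cls x) = cls (word_act p x)"
  unfolding act_map_def by (simp, rule word_act_cong) (simp_all add: f_inv_into_f)

lemma triangle_map_act_map: "triangle_map scale bracket X C act_map"
proof -
  have "act_map \<in> carrier UL \<rightarrow>\<^sub>E carrier U \<rightarrow>\<^sub>E carrier U"
    by (simp add: act_map_def)
  then show ?thesis
    unfolding triangle_map_def bilinear_map_def Let_def
    by (auto simp: carrier_uea uea_simps uea_incl_def act_map_cls word_act_add word_act_add_right word_act_const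
        word_act_const_mult_right word_act_one word_act_mult word_act_letter gL_op_X gL_op_T T_one)
qed

text \<open>Both maps are given by \<open>word_act\<close> on classes, and classes exhaust the
  carriers. Outside the carriers both are fixed by extensionality, which is applied once for each
  argument.\<close>

lemma triangle_map_unique:
  assumes "triangle_map scale bracket X C act"
  shows "act = act_map"
proof -
  have PiE: "f \<in> carrier UL \<rightarrow>\<^sub>E carrier U \<rightarrow>\<^sub>E carrier U" if "triangle_map scale bracket X C f" for f
    using that by (simp add: triangle_map_def Let_def)
  show ?thesis
  proof (rule PiE_ext[OF PiE[OF assms] PiE[OF triangle_map_act_map]])
    fix a assume a: "a \<in> carrier UL"
    show "act a = act_map a"
      by (rule PiE_ext[OF PiE_mem[OF PiE[OF assms] a] PiE_mem[OF PiE[OF triangle_map_act_map] a]])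
        (use a in \<open>auto simp: carrier_uea triangle_map_cls[OF assms] act_map_cls\<close>)
  qed
qed

text \<open>The action laws are among the defining conditions; that these can be met at all is the
  content of \<open>triangle_map_act_map\<close>.\<close>

lemma left_action_triangle_map:
  "triangle_map scale bracket X C act \<Longrightarrow> left_action UL U act"
  by (simp add: triangle_map_def left_action_def Let_def)

text \<open>On classes T_\<mu>\<nu> acts through the operator \<open>T\<close>, so the rule is the
  image of \<open>T_mult\<close> in the quotient.\<close>

lemma triangle_map_coproduct:
  assumes "triangle_map scale bracket X C act" "x \<in> carrier U" "y \<in> carrier U"
  defines "\<iota>T \<equiv> \<lambda>\<mu> \<nu>. uea_incl (*s) (gL_bracket C) (gL_T \<mu> \<nu>)"
  shows "act (\<iota>T \<mu> \<nu>) (x \<otimes>\<^bsub>U\<^esub> y) = (\<Oplus>\<^bsub>U\<^esub>\<alpha>\<in>UNIV. act (\<iota>T \<mu> \<alpha>) x \<otimes>\<^bsub>U\<^esub> act (\<iota>T \<alpha> \<nu>) y)"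
  using assms(2,3)
  by (auto simp: carrier_uea \<iota>T_def uea_incl_def uea_mult triangle_map_cls[OF assms(1)] word_act_letter
      gL_op_T T_mult uea_finsum)

end

theorem theorem1:
  fixes scale :: "'k::real_normed_field \<Rightarrow> 'g::ab_group_add \<Rightarrow> 'g"
    and bracket :: "'g \<Rightarrow> 'g \<Rightarrow> 'g"
    and X :: "'n::finite \<Rightarrow> 'g"
    and C :: "'n \<Rightarrow> 'n \<Rightarrow> 'n \<Rightarrow> 'k"
  assumes "lie_algebra scale bracket"
    and "vector_space.indexed_basis scale X"
    and "\<And>\<mu> \<nu>. bracket (X \<mu>) (X \<nu>) = (\<Sum>\<alpha>\<in>UNIV. scale (C \<mu> \<nu> \<alpha>) (X \<alpha>))"
  shows "(\<exists>!act. triangle_map scale bracket X C act) \<and>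
    (\<forall>act. triangle_map scale bracket X C act \<longrightarrow>
      (let U = uea scale bracket; UL = uea (*s) (gL_bracket C);
           T = (\<lambda>\<mu> \<nu>. uea_incl (*s) (gL_bracket C) (gL_T \<mu> \<nu>))
       in left_action UL U act \<and>
          (\<forall>x\<in>carrier U. \<forall>y\<in>carrier U. \<forall>\<mu> \<nu>.
             act (T \<mu> \<nu>) (x \<otimes>\<^bsub>U\<^esub> y) =
             (\<Oplus>\<^bsub>U\<^esub>\<alpha>\<in>UNIV. act (T \<mu> \<alpha>) x \<otimes>\<^bsub>U\<^esub> act (T \<alpha> \<nu>) y))))"
proof -
  interpret based_lie_algebra scale bracket X C
    by (intro based_lie_algebra.intro based_lie_algebra_axioms.intro assms)
  show ?thesis
    unfolding Let_def
    using triangle_map_act_map triangle_map_unique left_action_triangle_map triangle_map_coproduct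
    by blast
qed

end
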